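(* Let $G$ be a finitely generated group, and let $S \subset G$ be a generating set such that $G/[G,G]$ has finite diameter with respect to the word metric given by (the image of) $S$. Then $G$ is nilpotent-bounded with respect to $S$.
   Context: For a group $Q$ generated by a (possibly infinite) set $T$, the word metric is the one given by word length in $T \cup T^{-1}$; $Q$ has finite diameter with respect to $T$ if there is a constant $C$ such that every element of $Q$ is a product of at most $C$ elements of $T \cup T^{-1}$. A group $G$ is called nilpotent-bounded with respect to a set $S \subset G$ if every nilpotent quotient of $G$ has finite diameter with respect to the word metric given by the image of $S$ in that quotient. *)

theory Defs
  imports "HOL-Algebra.Generated_Groups"
begin

definition finitely_generated_group :: "('a, 'b) monoid_scheme \<Rightarrow> bool"
  where "finitely_generated_group G \<longleftrightarrow>
    group G \<and> (\<exists>A. finite A \<and> A \<subseteq> carrier G \<and> generate G A = carrier G)"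

text \<open>The commutator convention is that of \<^const>\<open>derived\<close>.\<close>

definition commutator_subgroup ::
    "('a, 'b) monoid_scheme \<Rightarrow> 'a set \<Rightarrow> 'a set \<Rightarrow> 'a set"
  where "commutator_subgroup G H K =
    generate G (\<Union>h\<in>H. \<Union>k\<in>K. {h \<otimes>\<^bsub>G\<^esub> k \<otimes>\<^bsub>G\<^esub> inv\<^bsub>G\<^esub> h \<otimes>\<^bsub>G\<^esub> inv\<^bsub>G\<^esub> k})"

text \<open>Indexing starts at 0, so term \<open>n\<close> here is usually written \<open>\<gamma>\<close> with index \<open>n + 1\<close>.\<close>

primrec lower_central :: "('a, 'b) monoid_scheme \<Rightarrow> nat \<Rightarrow> 'a set"
  where
    "lower_central G 0 = carrier G"
  | "lower_central G (Suc n) = commutator_subgroup G (lower_central G n) (carrier G)"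

definition nilpotent_group :: "('a, 'b) monoid_scheme \<Rightarrow> bool"
  where "nilpotent_group G \<longleftrightarrow> group G \<and> (\<exists>c. lower_central G c = {\<one>\<^bsub>G\<^esub>})"

text \<open>The list \<open>ws\<close> is a word in \<open>T\<close> and its inverses; the empty word represents the identity.\<close>

definition finite_diameter :: "('a, 'b) monoid_scheme \<Rightarrow> 'a set \<Rightarrow> bool"
  where "finite_diameter Q T \<longleftrightarrow>
    (\<exists>C::nat. \<forall>x\<in>carrier Q. \<exists>ws.
      set ws \<subseteq> T \<union> m_inv Q ` T \<and> length ws \<le> C \<and> x = foldr (\<otimes>\<^bsub>Q\<^esub>) ws \<one>\<^bsub>Q\<^esub>)"

definition quotient_image :: "('a, 'b) monoid_scheme \<Rightarrow> 'a set \<Rightarrow> 'a set \<Rightarrow> 'a set set"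
  where "quotient_image G N S = (\<lambda>s. N #>\<^bsub>G\<^esub> s) ` S"

definition nilpotent_bounded :: "('a, 'b) monoid_scheme \<Rightarrow> 'a set \<Rightarrow> bool"
  where "nilpotent_bounded G S \<longleftrightarrow>
    (\<forall>N. N \<lhd> G \<longrightarrow> nilpotent_group (G Mod N) \<longrightarrow>
      finite_diameter (G Mod N) (quotient_image G N S))"

end

theory Submission
  imports Defs
begin

text \<open>Words are lifted to the quotients by the terms of the lower central series \<open>\<gamma>\<close>, one term
  at a time. In \<open>Q = G/\<gamma>\<^sub>n\<^sub>+\<^sub>2\<close> the term \<open>\<gamma>\<^sub>n\<^sub>+\<^sub>1\<close> is central, so the commutator
  \<open>\<gamma>\<^sub>n \<times> Q \<rightarrow> \<gamma>\<^sub>n\<^sub>+\<^sub>1\<close> is multiplicative in both arguments. Hence, for generators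
  \<open>a\<^sub>1, \<dots>, a\<^sub>k\<close> of \<open>Q\<close>, every element of \<open>\<gamma>\<^sub>n\<^sub>+\<^sub>1\<close> is a product of \<open>k\<close> commutators
  \<open>[g\<^sub>i, a\<^sub>i]\<close>. If \<open>Q/\<gamma>\<^sub>n\<^sub>+\<^sub>1\<close> has finite diameter, \<open>g\<^sub>i\<close> may be replaced by a word of
  bounded length, which changes it only by a central factor and leaves \<open>[g\<^sub>i, a\<^sub>i]\<close> unchanged.
  So \<open>\<gamma>\<^sub>n\<^sub>+\<^sub>1\<close> consists of words of bounded length, and \<open>Q\<close> has finite diameter.\<close>

section \<open>Balls of the word metric\<close>

text \<open>Collecting values of words makes bounded length a property of group elements, stable
  under products, inverses and homomorphisms; word lists do not appear beyond this section.\<close>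

definition word_ball :: "('a, 'b) monoid_scheme \<Rightarrow> 'a set \<Rightarrow> nat \<Rightarrow> 'a set"
  where "word_ball G S C =
    {foldr (\<otimes>\<^bsub>G\<^esub>) ws \<one>\<^bsub>G\<^esub> | ws. set ws \<subseteq> S \<union> m_inv G ` S \<and> length ws \<le> C}"

lemma finite_diameter_iff_word_ball:
  "finite_diameter Q T \<longleftrightarrow> (\<exists>C. carrier Q \<subseteq> word_ball Q T C)"
  unfolding finite_diameter_def word_ball_def by blast

lemma one_in_word_ball: "\<one>\<^bsub>G\<^esub> \<in> word_ball G S C"
  unfolding word_ball_def by (auto intro!: exI[of _ "[]"])

context group
begin

lemma foldr_mult_closed:
  "set ws \<subseteq> carrier G \<Longrightarrow> foldr (\<otimes>) ws \<one> \<in> carrier G"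
  by (induction ws) auto

lemma foldr_mult_append:
  "\<lbrakk>set us \<subseteq> carrier G; set ws \<subseteq> carrier G\<rbrakk>
    \<Longrightarrow> foldr (\<otimes>) (us @ ws) \<one> = foldr (\<otimes>) us \<one> \<otimes> foldr (\<otimes>) ws \<one>"
  by (induction us) (auto simp: foldr_mult_closed m_assoc simp del: foldr_append)

lemma inv_foldr_mult:
  "set ws \<subseteq> carrier G \<Longrightarrow> inv (foldr (\<otimes>) ws \<one>) = foldr (\<otimes>) (rev (map (m_inv G) ws)) \<one>"
proof (induction ws)
  case (Cons w ws)
  then have "foldr (\<otimes>) (rev (map (m_inv G) ws) @ [inv w]) \<one> =
      foldr (\<otimes>) (rev (map (m_inv G) ws)) \<one> \<otimes> foldr (\<otimes>) [inv w] \<one>"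
    by (intro foldr_mult_append) auto
  with Cons show ?case
    by (simp add: inv_mult_group foldr_mult_closed del: foldr_append)
qed simp

lemma word_ball_subset_carrier:
  assumes "S \<subseteq> carrier G"
  shows "word_ball G S C \<subseteq> carrier G"
proof -
  have "S \<union> m_inv G ` S \<subseteq> carrier G"
    using assms by auto
  then show ?thesis
    unfolding word_ball_def using foldr_mult_closed by (blast dest: order_trans)
qed

lemma word_ball_mult:
  assumes S: "S \<subseteq> carrier G" and x: "x \<in> word_ball G S m" and y: "y \<in> word_ball G S n"
  shows "x \<otimes> y \<in> word_ball G S (m + n)"
proof -
  from x obtain us where us: "set us \<subseteq> S \<union> m_inv G ` S" "length us \<le> m"
      "x = foldr (\<otimes>) us \<one>"
    unfolding word_ball_def by blast
  from y obtain ws where ws: "set ws \<subseteq> S \<union> m_inv G ` S" "length ws \<le> n"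
      "y = foldr (\<otimes>) ws \<one>"
    unfolding word_ball_def by blast
  have "S \<union> m_inv G ` S \<subseteq> carrier G"
    using S by auto
  then have "x \<otimes> y = foldr (\<otimes>) (us @ ws) \<one>"
    using us ws by (subst foldr_mult_append) auto
  then show ?thesis
    unfolding word_ball_def using us ws by (auto simp del: foldr_append intro!: exI[of _ "us @ ws"])
qed

lemma word_ball_inv:
  assumes S: "S \<subseteq> carrier G" and x: "x \<in> word_ball G S m"
  shows "inv x \<in> word_ball G S m"
proof -
  from x obtain ws where ws: "set ws \<subseteq> S \<union> m_inv G ` S" "length ws \<le> m"
      "x = foldr (\<otimes>) ws \<one>"
    unfolding word_ball_def by blast
  have "S \<union> m_inv G ` S \<subseteq> carrier G"
    using S by auto
  then have "inv x = foldr (\<otimes>) (rev (map (m_inv G) ws)) \<one>"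
    using ws inv_foldr_mult[of ws] by blast
  \<comment> \<open>The alphabet is closed under inversion, so the reversed word of inverses is
    again admissible and has the same length.\<close>
  moreover have "m_inv G ` (S \<union> m_inv G ` S) \<subseteq> S \<union> m_inv G ` S"
    using S by auto
  then have "set (rev (map (m_inv G) ws)) \<subseteq> S \<union> m_inv G ` S"
    using image_mono[OF ws(1), of "m_inv G"] by simp
  ultimately show ?thesis
    unfolding word_ball_def using ws(2)
    by (intro CollectI exI[of _ "rev (map (m_inv G) ws)"]) simp
qed

text \<open>The length \<open>C\<close> depends on \<open>x\<close>. This suffices to give each
  member of a finite generating set some length, even when \<open>S\<close> is infinite.\<close>

lemma generate_in_word_ball:
  assumes S: "S \<subseteq> carrier G" and x: "x \<in> generate G S"
  shows "\<exists>C. x \<in> word_ball G S C"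
  using x
proof induction
  case one
  show ?case
    using one_in_word_ball by blast
next
  case (incl h)
  then have "h = foldr (\<otimes>) [h] \<one>"
    using S by auto
  with incl have "h \<in> word_ball G S 1"
    unfolding word_ball_def by (intro CollectI exI[of _ "[h]"]) auto
  then show ?case ..
next
  case (inv h)
  then have "inv h = foldr (\<otimes>) [inv h] \<one>"
    using S by auto
  with inv have "inv h \<in> word_ball G S 1"
    unfolding word_ball_def by (intro CollectI exI[of _ "[inv h]"]) auto
  then show ?case ..
next
  case (eng x y)
  then show ?case
    using word_ball_mult[OF S] by blast
qed

end

section \<open>Balls under homomorphisms and the diameter of quotients\<close>

lemma (in group_hom) word_ball_img:
  assumes S: "S \<subseteq> carrier G"
  shows "h ` word_ball G S C = word_ball H (h ` S) C"
proof -
  let ?L = "S \<union> m_inv G ` S"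
  have L: "?L \<subseteq> carrier G"
    using S by auto
  have img: "h ` ?L = h ` S \<union> m_inv H ` h ` S"
    using S by (force simp: image_Un image_image)
  have hom: "h (foldr (\<otimes>\<^bsub>G\<^esub>) ws \<one>\<^bsub>G\<^esub>) = foldr (\<otimes>\<^bsub>H\<^esub>) (map h ws) \<one>\<^bsub>H\<^esub>" if "set ws \<subseteq> ?L" for ws
    using that
  proof (induction ws)
    case (Cons w ws)
    then have "w \<in> ?L" "set ws \<subseteq> ?L"
      by simp_all
    with L have "w \<in> carrier G" "set ws \<subseteq> carrier G"
      by blast+
    with Cons show ?case
      by (simp add: G.foldr_mult_closed)
  qed simp
  show ?thesis
  proof
    show "h ` word_ball G S C \<subseteq> word_ball H (h ` S) C"
    proof
      fix y assume "y \<in> h ` word_ball G S C"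
      then obtain ws where ws: "set ws \<subseteq> ?L" "length ws \<le> C" "y = h (foldr (\<otimes>\<^bsub>G\<^esub>) ws \<one>\<^bsub>G\<^esub>)"
        unfolding word_ball_def by blast
      then have "set (map h ws) \<subseteq> h ` S \<union> m_inv H ` h ` S"
        unfolding img[symmetric] by auto
      then show "y \<in> word_ball H (h ` S) C"
        unfolding word_ball_def using ws hom by (intro CollectI exI[of _ "map h ws"]) simp
    qed
    show "word_ball H (h ` S) C \<subseteq> h ` word_ball G S C"
    proof
      fix y assume "y \<in> word_ball H (h ` S) C"
      then obtain vs where vs: "set vs \<subseteq> h ` ?L" "length vs \<le> C" "y = foldr (\<otimes>\<^bsub>H\<^esub>) vs \<one>\<^bsub>H\<^esub>"
        unfolding word_ball_def img by blast
      \<comment> \<open>Each letter of \<open>vs\<close> is the image of a letter in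
        \<open>?L\<close>, so the word lifts letter by letter without changing its length.\<close>
      then have "vs \<in> lists (h ` ?L)"
        by auto
      then have "vs \<in> map h ` lists ?L"
        by (simp add: lists_image)
      then obtain ws where ws: "vs = map h ws" "set ws \<subseteq> ?L"
        by auto
      have "foldr (\<otimes>\<^bsub>G\<^esub>) ws \<one>\<^bsub>G\<^esub> \<in> word_ball G S C"
        unfolding word_ball_def using ws vs by auto
      then show "y \<in> h ` word_ball G S C"
        using hom[OF ws(2)] ws(1) vs(3) by force
    qed
  qed
qed

text \<open>The image of a ball element \<open>w\<close> equals the coset of \<open>x\<close>
  exactly when \<open>x\<close> lies in the coset of \<open>w\<close>, and the bound
  \<open>C\<close> is the same on both sides. Thus all quotients are compared inside
  \<open>G\<close>, with the same balls and varying normal subgroups.\<close>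

lemma (in normal) finite_diameter_quotient_iff:
  assumes S: "S \<subseteq> carrier G"
  shows "finite_diameter (G Mod H) (quotient_image G H S) \<longleftrightarrow>
    (\<exists>C. carrier G \<subseteq> H <#> word_ball G S C)"
proof -
  interpret Q: group "G Mod H"
    by (rule factorgroup_is_group)
  interpret pr: group_hom G "G Mod H" "\<lambda>a. H #> a"
    by unfold_locales (rule r_coset_hom_Mod)
  have "H #> x \<in> (#>) H ` word_ball G S C \<longleftrightarrow> x \<in> H <#> word_ball G S C"
    if x: "x \<in> carrier G" for x C
  proof
    assume "H #> x \<in> (#>) H ` word_ball G S C"
    then obtain w where w: "w \<in> word_ball G S C" "H #> x = H #> w"
      by auto
    then have "x \<in> H #> w"
      using rcos_self[OF x subgroup_axioms] by simp
    then show "x \<in> H <#> word_ball G S C"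
      using w(1) by (auto simp: r_coset_def set_mult_def)
  next
    assume "x \<in> H <#> word_ball G S C"
    then obtain w where w: "w \<in> word_ball G S C" "x \<in> H #> w"
      by (auto simp: r_coset_def set_mult_def)
    moreover have "w \<in> carrier G"
      using w(1) word_ball_subset_carrier[OF S] by blast
    ultimately have "H #> w = H #> x"
      using repr_independence subgroup_axioms by blast
    then show "H #> x \<in> (#>) H ` word_ball G S C"
      using w(1) by (metis imageI)
  qed
  then show ?thesis
    unfolding finite_diameter_iff_word_ball quotient_image_def
      pr.word_ball_img[OF S, symmetric] carrier_FactGroup
    by (simp add: image_subset_iff) blast
qed

section \<open>Commutators and the lower central series\<close>

abbreviation commutator :: "('a, 'b) monoid_scheme \<Rightarrow> 'a \<Rightarrow> 'a \<Rightarrow> 'a"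
  where "commutator G x y \<equiv> x \<otimes>\<^bsub>G\<^esub> y \<otimes>\<^bsub>G\<^esub> inv\<^bsub>G\<^esub> x \<otimes>\<^bsub>G\<^esub> inv\<^bsub>G\<^esub> y"

definition group_center :: "('a, 'b) monoid_scheme \<Rightarrow> 'a set"
  where "group_center G = {z \<in> carrier G. \<forall>x\<in>carrier G. z \<otimes>\<^bsub>G\<^esub> x = x \<otimes>\<^bsub>G\<^esub> z}"

text \<open>Both sides use the same order of factors in a commutator. The identity turns the
  hypothesis on the abelianization into the start of the induction.\<close>

lemma lower_central_1: "lower_central G (Suc 0) = derived G (carrier G)"
  by (simp add: commutator_subgroup_def derived_def)

section \<open>Commutator identities modulo the centre\<close>

context group
begin

text \<open>Once \<open>m_assoc\<close> has nested products to the right, an adjacent inverse pair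
  is separated by a bracket; these rules cancel it.\<close>

lemma inv_mult_cancel_left:
  "\<lbrakk>x \<in> carrier G; y \<in> carrier G\<rbrakk> \<Longrightarrow> inv x \<otimes> (x \<otimes> y) = y"
  "\<lbrakk>x \<in> carrier G; y \<in> carrier G\<rbrakk> \<Longrightarrow> x \<otimes> (inv x \<otimes> y) = y"
  by (simp_all add: m_assoc[symmetric])

lemma commutator_eq_one_iff:
  assumes "x \<in> carrier G" "y \<in> carrier G"
  shows "commutator G x y = \<one> \<longleftrightarrow> x \<otimes> y = y \<otimes> x"
proof -
  have "commutator G x y \<otimes> (y \<otimes> x) = x \<otimes> y"
    using assms by (simp add: m_assoc inv_mult_cancel_left)
  then show ?thesis
    using assms by (metis l_one m_closed inv_closed r_cancel_one)
qed

text \<open>In any group \<open>[xy,a] = x [y,a] (a x^-1 a^-1)\<close>. Moving the central factor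
  \<open>[y,a]\<close> to the right end leaves \<open>[x,a]\<close> in front of it.\<close>

lemma commutator_mult_left:
  assumes "x \<in> carrier G" "y \<in> carrier G" "a \<in> carrier G"
    and "commutator G y a \<in> group_center G"
  shows "commutator G (x \<otimes> y) a = commutator G x a \<otimes> commutator G y a"
proof -
  have "commutator G (x \<otimes> y) a = x \<otimes> commutator G y a \<otimes> (a \<otimes> inv x \<otimes> inv a)"
    using assms(1-3) by (simp add: m_assoc inv_mult_group inv_mult_cancel_left)
  also have "\<dots> = x \<otimes> (commutator G y a \<otimes> (a \<otimes> inv x \<otimes> inv a))"
    using assms(1-3) by (simp add: m_assoc)
  also have "commutator G y a \<otimes> (a \<otimes> inv x \<otimes> inv a) = (a \<otimes> inv x \<otimes> inv a) \<otimes> commutator G y a"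
    using assms by (simp add: group_center_def)
  also have "x \<otimes> \<dots> = commutator G x a \<otimes> commutator G y a"
    using assms(1-3) by (simp add: m_assoc)
  finally show ?thesis .
qed

text \<open>In any group \<open>[x,ab] = [x,a] (a [x,b] a^-1)\<close>, and conjugation fixes the
  central factor \<open>[x,b]\<close>.\<close>

lemma commutator_mult_right:
  assumes "x \<in> carrier G" "a \<in> carrier G" "b \<in> carrier G"
    and "commutator G x b \<in> group_center G"
  shows "commutator G x (a \<otimes> b) = commutator G x a \<otimes> commutator G x b"
proof -
  have "commutator G x (a \<otimes> b) = commutator G x a \<otimes> (a \<otimes> commutator G x b \<otimes> inv a)"
    using assms(1-3) by (simp add: m_assoc inv_mult_group inv_mult_cancel_left)
  also have "a \<otimes> commutator G x b \<otimes> inv a = commutator G x b \<otimes> a \<otimes> inv a"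
    using assms by (simp add: group_center_def)
  also have "\<dots> = commutator G x b"
    using assms(1-3) by (simp add: m_assoc)
  finally show ?thesis .
qed

text \<open>The commutator sees its first argument only modulo the centre. This is what allows an
  arbitrary element to be replaced by a short word.\<close>

lemma commutator_center_mult_left:
  assumes "z \<in> group_center G" "x \<in> carrier G" "a \<in> carrier G"
  shows "commutator G (z \<otimes> x) a = commutator G x a"
proof -
  have z: "z \<in> carrier G" "inv z \<in> carrier G"
    using assms(1) by (auto simp: group_center_def)
  have "commutator G (z \<otimes> x) a = z \<otimes> (x \<otimes> a \<otimes> inv x) \<otimes> inv z \<otimes> inv a"
    using assms(2,3) z by (simp add: m_assoc inv_mult_group)
  also have "z \<otimes> (x \<otimes> a \<otimes> inv x) = (x \<otimes> a \<otimes> inv x) \<otimes> z"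
    using assms by (simp add: group_center_def)
  also have "(x \<otimes> a \<otimes> inv x) \<otimes> z \<otimes> inv z \<otimes> inv a = commutator G x a"
    using assms(2,3) z by (simp add: m_assoc)
  finally show ?thesis .
qed

lemma commutator_inv_left:
  assumes "x \<in> carrier G" "a \<in> carrier G" "commutator G x a \<in> group_center G"
  shows "commutator G (inv x) a = inv (commutator G x a)"
proof -
  have "commutator G (inv x \<otimes> x) a = commutator G (inv x) a \<otimes> commutator G x a"
    using assms by (intro commutator_mult_left) auto
  moreover have "commutator G (inv x \<otimes> x) a = \<one>"
    using assms by simp
  ultimately show ?thesis
    using assms by (intro inv_equality[symmetric]) auto
qed

lemma commutator_inv_right:
  assumes "x \<in> carrier G" "a \<in> carrier G" "commutator G x a \<in> group_center G"
  shows "commutator G x (inv a) = inv (commutator G x a)"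
proof -
  have "commutator G x (inv a \<otimes> a) = commutator G x (inv a) \<otimes> commutator G x a"
    using assms by (intro commutator_mult_right) auto
  moreover have "commutator G x (inv a \<otimes> a) = \<one>"
    using assms by simp
  ultimately show ?thesis
    using assms by (intro inv_equality[symmetric]) auto
qed

section \<open>Normality, descent and images of the lower central terms\<close>

lemma commutator_conj:
  assumes "g \<in> carrier G" "x \<in> carrier G" "y \<in> carrier G"
  shows "g \<otimes> commutator G x y \<otimes> inv g = commutator G (g \<otimes> x \<otimes> inv g) (g \<otimes> y \<otimes> inv g)"
  using assms by (simp add: m_assoc inv_mult_group inv_mult_cancel_left)

text \<open>A conjugate of a commutator is the commutator of the conjugates, so already the
  generating set is invariant under conjugation.\<close>

lemma commutator_subgroup_normal:
  assumes "H \<lhd> G" "K \<lhd> G"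
  shows "commutator_subgroup G H K \<lhd> G"
proof -
  interpret H: normal H G by fact
  interpret K: normal K G by fact
  show ?thesis
    unfolding commutator_subgroup_def
  proof (rule normal_generateI)
    show "(\<Union>h\<in>H. \<Union>k\<in>K. {commutator G h k}) \<subseteq> carrier G"
      using H.subset K.subset by auto
  next
    fix c g
    assume "c \<in> (\<Union>h\<in>H. \<Union>k\<in>K. {commutator G h k})" and g: "g \<in> carrier G"
    then obtain h k where hk: "h \<in> H" "k \<in> K" "c = commutator G h k"
      by auto
    then have "g \<otimes> c \<otimes> inv g = commutator G (g \<otimes> h \<otimes> inv g) (g \<otimes> k \<otimes> inv g)"
      using commutator_conj g H.subset K.subset by blast
    then show "g \<otimes> c \<otimes> inv g \<in> (\<Union>h\<in>H. \<Union>k\<in>K. {commutator G h k})"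
      using H.inv_op_closed2[OF g hk(1)] K.inv_op_closed2[OF g hk(2)] by blast
  qed
qed

lemma lower_central_normal: "lower_central G n \<lhd> G"
  by (induction n) (simp_all add: normal_self commutator_subgroup_normal)

lemma lower_central_subset_carrier: "lower_central G n \<subseteq> carrier G"
  using lower_central_normal normal_imp_subgroup subgroup.subset by blast

lemma commutator_in_lower_central:
  "\<lbrakk>x \<in> lower_central G n; y \<in> carrier G\<rbrakk> \<Longrightarrow> commutator G x y \<in> lower_central G (Suc n)"
  by (auto simp: commutator_subgroup_def intro!: generate.incl)

lemma lower_central_Suc_subset: "lower_central G (Suc n) \<subseteq> lower_central G n"
proof -
  interpret L: normal "lower_central G n" G
    by (rule lower_central_normal)
  show ?thesis
    unfolding lower_central.simps commutator_subgroup_def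
  proof (rule generate_subgroup_incl[OF _ L.subgroup_axioms], safe)
    fix x y assume x: "x \<in> lower_central G n" and y: "y \<in> carrier G"
    \<comment> \<open>Rebracketed, \<open>[x,y]\<close> is \<open>x\<close> times a conjugate of
      \<open>inv x\<close>, and both factors lie in the normal subgroup.\<close>
    have "x \<otimes> (y \<otimes> inv x \<otimes> inv y) \<in> lower_central G n"
      using x y L.inv_op_closed2 L.m_inv_closed by blast
    then show "commutator G x y \<in> lower_central G n"
      using x y L.mem_carrier by (simp add: m_assoc)
  qed
qed

lemma lower_central_subset_center:
  assumes "lower_central G (Suc n) = {\<one>}"
  shows "lower_central G n \<subseteq> group_center G"
proof
  fix z assume z: "z \<in> lower_central G n"
  then have "z \<in> carrier G"
    using lower_central_subset_carrier by blast
  moreover have "commutator G z x = \<one>" if "x \<in> carrier G" for x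
    using commutator_in_lower_central[OF z that] assms by simp
  ultimately show "z \<in> group_center G"
    by (simp add: group_center_def commutator_eq_one_iff)
qed

end

text \<open>Surjectivity enters at every stage, because the second argument of the commutators runs
  through the whole group.\<close>

lemma (in group_hom) lower_central_img:
  assumes surj: "h ` carrier G = carrier H"
  shows "h ` lower_central G n = lower_central H n"
proof (induction n)
  case (Suc n)
  let ?L = "lower_central G n"
  have L: "?L \<subseteq> carrier G"
    by (rule G.lower_central_subset_carrier)
  have "h (commutator G x y) = commutator H (h x) (h y)" if "x \<in> ?L" "y \<in> carrier G" for x y
    using that L by (simp add: subset_iff)
  then have "h ` (\<Union>x\<in>?L. \<Union>y\<in>carrier G. {commutator G x y}) =
      (\<Union>x\<in>?L. \<Union>y\<in>carrier G. {commutator H (h x) (h y)})"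
    by (simp add: image_UN)
  also have "\<dots> = (\<Union>x\<in>h ` ?L. \<Union>y\<in>h ` carrier G. {commutator H x y})"
    by simp
  also have "\<dots> = (\<Union>x\<in>lower_central H n. \<Union>y\<in>carrier H. {commutator H x y})"
    by (simp only: Suc.IH surj)
  finally show ?case
    unfolding lower_central.simps commutator_subgroup_def
    using L by (subst generate_img[symmetric]) auto
qed (simp add: surj)

section \<open>Bounded generation of a central term\<close>

context group
begin

text \<open>With central values, \<open>g \<mapsto> [g,a]\<close> is a homomorphism on
  \<open>H\<close>. A product of arbitrarily many commutators with the same \<open>a\<close>
  therefore collapses to a single one.\<close>

lemma subgroup_commutators_left:
  assumes "subgroup H G" and a: "a \<in> carrier G"
    and central: "\<And>g. g \<in> H \<Longrightarrow> commutator G g a \<in> group_center G"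
  shows "subgroup ((\<lambda>g. commutator G g a) ` H) G"
proof -
  interpret H: subgroup H G by fact
  show ?thesis
  proof (rule subgroupI)
    show "(\<lambda>g. commutator G g a) ` H \<subseteq> carrier G"
      using a by auto
    show "(\<lambda>g. commutator G g a) ` H \<noteq> {}"
      using H.one_closed by blast
  next
    fix c assume "c \<in> (\<lambda>g. commutator G g a) ` H"
    then obtain g where g: "g \<in> H" "c = commutator G g a"
      by blast
    then have "inv c = commutator G (inv g) a"
      using commutator_inv_left[OF H.mem_carrier a central] by metis
    then show "inv c \<in> (\<lambda>g. commutator G g a) ` H"
      using H.m_inv_closed[OF g(1)] by blast
  next
    fix c d assume "c \<in> (\<lambda>g. commutator G g a) ` H" "d \<in> (\<lambda>g. commutator G g a) ` H"
    then obtain g k where "g \<in> H" "k \<in> H" "c = commutator G g a" "d = commutator G k a"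
      by blast
    then have "c \<otimes> d = commutator G (g \<otimes> k) a" "g \<otimes> k \<in> H"
      using a central by (simp_all add: commutator_mult_left)
    then show "c \<otimes> d \<in> (\<lambda>g. commutator G g a) ` H"
      by blast
  qed
qed

lemma subgroup_set_mult_central:
  assumes "subgroup F G" "subgroup K G" "F \<subseteq> group_center G"
  shows "subgroup (F <#> K) G"
proof -
  interpret F: subgroup F G by fact
  interpret K: subgroup K G by fact
  have comm: "f \<otimes> k = k \<otimes> f" if "f \<in> F" "k \<in> carrier G" for f k
    using assms(3) that by (auto simp: group_center_def)
  show ?thesis
  proof (rule subgroupI)
    show "F <#> K \<subseteq> carrier G"
      by (auto simp: set_mult_def)
    show "F <#> K \<noteq> {}"
      using F.one_closed K.one_closed unfolding set_mult_def by blast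
  next
    fix c assume "c \<in> F <#> K"
    then obtain f k where fk: "f \<in> F" "k \<in> K" "c = f \<otimes> k"
      by (auto simp: set_mult_def)
    then have "inv c = inv f \<otimes> inv k"
      using comm[of "inv f" "inv k"] by (simp add: inv_mult_group)
    then show "inv c \<in> F <#> K"
      using fk by (auto simp: set_mult_def)
  next
    fix c d assume "c \<in> F <#> K" "d \<in> F <#> K"
    then obtain f k f' k' where *: "f \<in> F" "k \<in> K" "f' \<in> F" "k' \<in> K" "c = f \<otimes> k" "d = f' \<otimes> k'"
      by (auto simp: set_mult_def)
    have "c \<otimes> d = f \<otimes> (k \<otimes> f') \<otimes> k'"
      using * by (simp add: m_assoc)
    also have "k \<otimes> f' = f' \<otimes> k"
      using comm[of f' k] * by simp
    also have "f \<otimes> (f' \<otimes> k) \<otimes> k' = (f \<otimes> f') \<otimes> (k \<otimes> k')"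
      using * by (simp add: m_assoc)
    finally show "c \<otimes> d \<in> F <#> K"
      using * by (auto simp: set_mult_def)
  qed
qed

lemma group_center_mult_closed:
  assumes "x \<in> group_center G" "y \<in> group_center G"
  shows "x \<otimes> y \<in> group_center G"
proof -
  have c: "x \<in> carrier G" "y \<in> carrier G"
    using assms by (auto simp: group_center_def)
  have "x \<otimes> y \<otimes> g = g \<otimes> (x \<otimes> y)" if g: "g \<in> carrier G" for g
  proof -
    have "x \<otimes> y \<otimes> g = x \<otimes> (y \<otimes> g)"
      using c g by (simp add: m_assoc)
    also have "y \<otimes> g = g \<otimes> y"
      using assms(2) g by (simp add: group_center_def)
    also have "x \<otimes> (g \<otimes> y) = x \<otimes> g \<otimes> y"
      using c g by (simp add: m_assoc)
    also have "x \<otimes> g = g \<otimes> x"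
      using assms(1) g by (simp add: group_center_def)
    also have "g \<otimes> x \<otimes> y = g \<otimes> (x \<otimes> y)"
      using c g by (simp add: m_assoc)
    finally show ?thesis .
  qed
  with c show ?thesis
    unfolding group_center_def by blast
qed

lemma bounded_commutators_generator:
  assumes T: "T \<subseteq> carrier G" "generate G T = carrier G"
    and H: "H \<subseteq> group_center G <#> word_ball G T C"
    and a: "a \<in> carrier G"
  shows "\<exists>D. \<forall>g\<in>H. commutator G g a \<in> word_ball G T D"
proof -
  obtain L where L: "a \<in> word_ball G T L"
    using generate_in_word_ball a T by blast
  \<comment> \<open>The four summands are the lengths of \<open>w\<close>, \<open>a\<close>,
    \<open>inv w\<close> and \<open>inv a\<close>, where \<open>w\<close> is a ball element
    congruent to \<open>g\<close> modulo the centre. The bound is independent of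
    \<open>g\<close>.\<close>
  have "commutator G g a \<in> word_ball G T (C + L + C + L)" if g: "g \<in> H" for g
  proof -
    obtain z w where zw: "z \<in> group_center G" "w \<in> word_ball G T C" "g = z \<otimes> w"
      using g H unfolding set_mult_def by blast
    then have "w \<in> carrier G"
      using word_ball_subset_carrier[OF T(1)] by blast
    then have "commutator G g a = commutator G w a"
      using zw a commutator_center_mult_left by blast
    then show ?thesis
      using zw(2) L by (auto intro!: word_ball_mult word_ball_inv T(1))
  qed
  then show ?thesis
    by blast
qed

text \<open>\<open>F\<close> is built as the product of the central subgroups \<open>[H,a]\<close>
  for \<open>a\<close> in \<open>A\<close>. Each factor has bounded length and the bounds add up, so
  the finiteness of \<open>A\<close> makes \<open>D\<close> finite.\<close>

lemma bounded_central_subgroup_of_commutators: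
  assumes T: "T \<subseteq> carrier G" "generate G T = carrier G"
    and H: "subgroup H G" "H \<subseteq> group_center G <#> word_ball G T C"
    and central: "\<And>g x. \<lbrakk>g \<in> H; x \<in> carrier G\<rbrakk> \<Longrightarrow> commutator G g x \<in> group_center G"
    and A: "finite A" "A \<subseteq> carrier G"
  shows "\<exists>F D. subgroup F G \<and> F \<subseteq> group_center G \<and> F \<subseteq> word_ball G T D \<and>
    (\<forall>g\<in>H. \<forall>a\<in>A. commutator G g a \<in> F)"
  using A
proof (induction A)
  case empty
  have "{\<one>} \<subseteq> group_center G" "{\<one>} \<subseteq> word_ball G T 0"
    by (auto simp: group_center_def one_in_word_ball)
  then show ?case
    using triv_subgroup by blast
next
  case (insert a A)
  then have a: "a \<in> carrier G"
    by simp
  from insert obtain F D where F: "subgroup F G" "F \<subseteq> group_center G" "F \<subseteq> word_ball G T D"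
      "\<forall>g\<in>H. \<forall>a\<in>A. commutator G g a \<in> F"
    by auto
  obtain E where E: "\<forall>g\<in>H. commutator G g a \<in> word_ball G T E"
    using bounded_commutators_generator[OF T H(2) a] by blast
  let ?K = "(\<lambda>g. commutator G g a) ` H"
  have K: "subgroup ?K G"
    using central a by (intro subgroup_commutators_left[OF H(1)]) auto
  have "subgroup (F <#> ?K) G"
    using subgroup_set_mult_central[OF F(1) K F(2)] .
  moreover have "F <#> ?K \<subseteq> group_center G"
    using F(2) central[OF _ a] group_center_mult_closed by (auto simp: set_mult_def)
  moreover have "F <#> ?K \<subseteq> word_ball G T (D + E)"
    using F(3) E word_ball_mult[OF T(1)] by (auto simp: set_mult_def)
  moreover have "commutator G g b \<in> F <#> ?K" if g: "g \<in> H" and b: "b \<in> insert a A" for g b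
  proof (cases "b = a")
    case True
    have "\<one> \<otimes> commutator G g a \<in> F <#> ?K"
      using g subgroup.one_closed[OF F(1)] unfolding set_mult_def by blast
    moreover have "\<one> \<otimes> commutator G g a = commutator G g a"
      using g a subgroup.mem_carrier[OF H(1)] by simp
    ultimately show ?thesis
      using True by simp
  next
    case False
    then have c: "commutator G g b \<in> F"
      using F(4) g b by blast
    then have "commutator G g b \<otimes> \<one> \<in> F <#> ?K"
      using subgroup.one_closed[OF K] unfolding set_mult_def by blast
    then show ?thesis
      using subgroup.mem_carrier[OF F(1) c] by simp
  qed
  ultimately show ?case
    by blast
qed

text \<open>Two generating sets interact: the finite set \<open>A\<close> bounds the number of
  commutator factors, while lengths are measured in the possibly infinite set
  \<open>T\<close>.\<close>

lemma bounded_central_commutator_subgroup: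
  assumes fg: "finitely_generated_group G"
    and T: "T \<subseteq> carrier G" "generate G T = carrier G"
    and H: "subgroup H G" "H \<subseteq> group_center G <#> word_ball G T C"
    and central: "\<And>g x. \<lbrakk>g \<in> H; x \<in> carrier G\<rbrakk> \<Longrightarrow> commutator G g x \<in> group_center G"
  shows "\<exists>D. commutator_subgroup G H (carrier G) \<subseteq> word_ball G T D"
proof -
  obtain A where A: "finite A" "A \<subseteq> carrier G" "generate G A = carrier G"
    using fg by (auto simp: finitely_generated_group_def)
  obtain F D where F: "subgroup F G" "F \<subseteq> word_ball G T D" "\<forall>g\<in>H. \<forall>a\<in>A. commutator G g a \<in> F"
    using bounded_central_subgroup_of_commutators[OF T H central A(1,2)] by blast
  interpret F: subgroup F G by (rule F(1))
  \<comment> \<open>Multiplicativity in the second argument extends membership in the subgroup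
    \<open>F\<close> from generators in \<open>A\<close> to all of \<open>G\<close>.\<close>
  have "commutator G g x \<in> F" if g: "g \<in> H" and "x \<in> generate G A" for g x
    using that(2)
  proof induction
    case one
    then show ?case
      using subgroup.mem_carrier[OF H(1) g] by simp
  next
    case (incl a)
    then show ?case
      using F(3) g by blast
  next
    case (inv a)
    then have "a \<in> carrier G" "commutator G g a \<in> F"
      using A(2) F(3) g by auto
    then show ?case
      using subgroup.mem_carrier[OF H(1) g] central[OF g] commutator_inv_right by simp
  next
    case (eng x y)
    then have "x \<in> carrier G" "y \<in> carrier G"
      using A(3) by auto
    then show ?case
      using eng subgroup.mem_carrier[OF H(1) g] central[OF g] commutator_mult_right by simp
  qed
  then have "commutator_subgroup G H (carrier G) \<subseteq> F"
    unfolding commutator_subgroup_def A(3)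
    by (intro generate_subgroup_incl[OF _ F(1)]) auto
  with F(2) show ?thesis
    by blast
qed

text \<open>The term of index \<open>Suc n\<close> is central, so the cover \<open>C\<close>
  represents each element of the term of index \<open>n\<close> by a ball element modulo the centre.
  This bounds the central term, and its bound is then added to \<open>C\<close>.\<close>

lemma carrier_in_word_ball_if_central_term:
  assumes fg: "finitely_generated_group G"
    and T: "T \<subseteq> carrier G" "generate G T = carrier G"
    and nil: "lower_central G (Suc (Suc n)) = {\<one>}"
    and C: "carrier G \<subseteq> lower_central G (Suc n) <#> word_ball G T C"
  shows "\<exists>D. carrier G \<subseteq> word_ball G T D"
proof -
  note center = lower_central_subset_center[OF nil]
  have "\<exists>D. commutator_subgroup G (lower_central G n) (carrier G) \<subseteq> word_ball G T D"
  proof (rule bounded_central_commutator_subgroup[OF fg T])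
    show "subgroup (lower_central G n) G"
      using lower_central_normal normal_imp_subgroup by blast
    have "lower_central G (Suc n) <#> word_ball G T C \<subseteq> group_center G <#> word_ball G T C"
      using center by (intro mono_set_mult) auto
    then show "lower_central G n \<subseteq> group_center G <#> word_ball G T C"
      using lower_central_subset_carrier C by blast
  next
    fix g x assume "g \<in> lower_central G n" "x \<in> carrier G"
    then show "commutator G g x \<in> group_center G"
      using commutator_in_lower_central center by blast
  qed
  then obtain D where "lower_central G (Suc n) \<subseteq> word_ball G T D"
    by auto
  then have "lower_central G (Suc n) <#> word_ball G T C \<subseteq> word_ball G T (D + C)"
    using word_ball_mult[OF T(1)] by (auto simp: set_mult_def)
  with C show ?thesis
    by blast
qed

end

section \<open>Induction along the lower central series and arbitrary nilpotent quotients\<close>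

lemma (in group_hom) finitely_generated_group_img:
  assumes "finitely_generated_group G" "h ` carrier G = carrier H"
  shows "finitely_generated_group H"
proof -
  obtain A where A: "finite A" "A \<subseteq> carrier G" "generate G A = carrier G"
    using assms(1) by (auto simp: finitely_generated_group_def)
  then have "finite (h ` A)" "h ` A \<subseteq> carrier H" "generate H (h ` A) = carrier H"
    using assms(2) by (auto simp: generate_img)
  then show ?thesis
    using H.is_group unfolding finitely_generated_group_def by blast
qed

text \<open>Dividing by the term of index \<open>Suc (Suc n)\<close> makes the preceding term
  central, so the bounded generation argument applies in the quotient; the resulting diameter bound
  is then pulled back to a cover of \<open>G\<close>.\<close>

lemma (in group) finite_diameter_lower_central_step:
  assumes fg: "finitely_generated_group G"
    and S: "S \<subseteq> carrier G" "generate G S = carrier G"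
    and C: "carrier G \<subseteq> lower_central G (Suc n) <#> word_ball G S C"
  shows "\<exists>D. carrier G \<subseteq> lower_central G (Suc (Suc n)) <#> word_ball G S D"
proof -
  define K where "K = lower_central G (Suc (Suc n))"
  interpret K: normal K G
    unfolding K_def by (rule lower_central_normal)
  interpret Q: group "G Mod K"
    by (rule K.factorgroup_is_group)
  interpret pr: group_hom G "G Mod K" "\<lambda>a. K #> a"
    by unfold_locales (rule K.r_coset_hom_Mod)
  let ?p = "\<lambda>a. K #> a"
  have surj: "?p ` carrier G = carrier (G Mod K)"
    by (simp add: carrier_FactGroup)
  have "\<exists>D. carrier (G Mod K) \<subseteq> word_ball (G Mod K) (?p ` S) D"
  proof (rule Q.carrier_in_word_ball_if_central_term)
    show "finitely_generated_group (G Mod K)"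
      by (rule pr.finitely_generated_group_img[OF fg surj])
    show "?p ` S \<subseteq> carrier (G Mod K)"
      using S(1) surj by blast
    show "generate (G Mod K) (?p ` S) = carrier (G Mod K)"
      by (simp only: pr.generate_img[OF S(1)] S(2) surj)
    \<comment> \<open>The projection maps each lower central term onto the term of the same index,
      so collapsing \<open>K\<close> makes that term of the quotient trivial.\<close>
    have "?p ` K = {\<one>\<^bsub>G Mod K\<^esub>}"
    proof -
      have "?p k = K" if "k \<in> K" for k
        using that K.mem_carrier coset_join2[OF _ K.subgroup_axioms] by blast
      then show ?thesis
        using K.one_closed by (auto simp: image_iff simp del: K.one_closed)
    qed
    then show "lower_central (G Mod K) (Suc (Suc n)) = {\<one>\<^bsub>G Mod K\<^esub>}"
      unfolding pr.lower_central_img[OF surj, symmetric] K_def[symmetric] .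
    have "?p ` carrier G \<subseteq> ?p ` (lower_central G (Suc n) <#> word_ball G S C)"
      using C by blast
    also have "\<dots> \<subseteq> ?p ` lower_central G (Suc n) <#>\<^bsub>G Mod K\<^esub> ?p ` word_ball G S C"
    proof
      fix y assume "y \<in> ?p ` (lower_central G (Suc n) <#> word_ball G S C)"
      then obtain u w where uw: "u \<in> lower_central G (Suc n)" "w \<in> word_ball G S C" "y = ?p (u \<otimes> w)"
        unfolding set_mult_def by blast
      then have "u \<in> carrier G" "w \<in> carrier G"
        using lower_central_subset_carrier word_ball_subset_carrier[OF S(1)] by blast+
      then have "y = ?p u \<otimes>\<^bsub>G Mod K\<^esub> ?p w"
        using uw(3) pr.hom_mult by simp
      then show "y \<in> ?p ` lower_central G (Suc n) <#>\<^bsub>G Mod K\<^esub> ?p ` word_ball G S C"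
        using uw(1,2) unfolding set_mult_def[of "G Mod K"] by blast
    qed
    finally show "carrier (G Mod K) \<subseteq>
        lower_central (G Mod K) (Suc n) <#>\<^bsub>G Mod K\<^esub> word_ball (G Mod K) (?p ` S) C"
      unfolding surj pr.lower_central_img[OF surj] pr.word_ball_img[OF S(1)] .
  qed
  then have "finite_diameter (G Mod K) (quotient_image G K S)"
    by (simp add: finite_diameter_iff_word_ball quotient_image_def)
  then show ?thesis
    using K.finite_diameter_quotient_iff[OF S(1)] unfolding K_def by blast
qed

text \<open>A lower central term of \<open>G\<close> maps onto that of the quotient; where the
  latter is trivial, the former lies in the kernel \<open>N\<close>.\<close>

lemma (in group) lower_central_subset_if_nilpotent_quotient:
  assumes N: "N \<lhd> G" and nil: "nilpotent_group (G Mod N)"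
  shows "\<exists>c. lower_central G (Suc c) \<subseteq> N"
proof -
  interpret N: normal N G by fact
  interpret Q: group "G Mod N"
    by (rule N.factorgroup_is_group)
  interpret pr: group_hom G "G Mod N" "\<lambda>a. N #> a"
    by unfold_locales (rule N.r_coset_hom_Mod)
  obtain c where "lower_central (G Mod N) c = {\<one>\<^bsub>G Mod N\<^esub>}"
    using nil by (auto simp: nilpotent_group_def)
  then have img: "(\<lambda>a. N #> a) ` lower_central G c = {N}"
    by (simp add: pr.lower_central_img carrier_FactGroup)
  have "lower_central G c \<subseteq> N"
  proof
    fix x assume x: "x \<in> lower_central G c"
    then have "x \<in> N #> x"
      using lower_central_subset_carrier rcos_self[OF _ N.subgroup_axioms] by blast
    with x img show "x \<in> N"
      by blast
  qed
  \<comment> \<open>The covers are established from index 1 on, so the index is raised by one; this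
    also handles \<open>c = 0\<close>, the case of a trivial quotient.\<close>
  then show ?thesis
    using lower_central_Suc_subset by blast
qed

theorem theorem1p2:
  fixes G :: "('a, 'b) monoid_scheme" and S :: "'a set"
  assumes "group G"
    and "finitely_generated_group G"
    and "S \<subseteq> carrier G"
    and "generate G S = carrier G"
    and "finite_diameter (G Mod (derived G (carrier G)))
           (quotient_image G (derived G (carrier G)) S)"
  shows "nilpotent_bounded G S"
proof -
  interpret group G by fact
  \<comment> \<open>\<open>C\<close> may grow with \<open>n\<close>; each nilpotent quotient needs
    only one value of \<open>n\<close>.\<close>
  have bounded: "\<exists>C. carrier G \<subseteq> lower_central G (Suc n) <#>\<^bsub>G\<^esub> word_ball G S C" for n
  proof (induction n)
    case 0
    show ?case
      unfolding lower_central_1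
      using assms(5) normal.finite_diameter_quotient_iff[OF derived_self_is_normal assms(3)] by blast
  next
    case (Suc n)
    then show ?case
      using finite_diameter_lower_central_step[OF assms(2-4)] by blast
  qed
  show ?thesis
    unfolding nilpotent_bounded_def
  proof (intro allI impI)
    fix N assume N: "N \<lhd> G" and nil: "nilpotent_group (G Mod N)"
    obtain c where c: "lower_central G (Suc c) \<subseteq> N"
      using lower_central_subset_if_nilpotent_quotient[OF N nil] by blast
    obtain C where "carrier G \<subseteq> lower_central G (Suc c) <#>\<^bsub>G\<^esub> word_ball G S C"
      using bounded by blast
    \<comment> \<open>Enlarging the lower central term to \<open>N\<close> preserves the cover and
      its bound, which gives the diameter of \<open>G Mod N\<close>.\<close>
    also have "\<dots> \<subseteq> N <#>\<^bsub>G\<^esub> word_ball G S C"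
      using c by (intro mono_set_mult) auto
    finally show "finite_diameter (G Mod N) (quotient_image G N S)"
      using normal.finite_diameter_quotient_iff[OF N assms(3)] by blast
  qed
qed

end
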